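(* Let $D=\{f(a,a): a\ge 0\}$ and $S=\{p\ge 1: \text{there exists an integer } r \text{ with } 0\le r<p \text{ such that } f(p,r)=p\}$. Then every positive integer belongs to exactly one of $D$ and $S$.
   Context: Three-row Chomp. A position is a triple $[p,q,r]$ of integers with $p\ge q\ge r\ge 0$ (row lengths). The moves from $[p,q,r]$ are: reduce the first row to length $a$ with $0\le a<p$, giving $[a,\min(a,q),\min(a,r)]$; reduce the second row to length $a$ with $0\le a<q$, giving $[p,a,\min(a,r)]$; reduce the third row to length $b$ with $0\le b<r$, giving $[p,q,b]$. The player who moves to $[0,0,0]$ loses. A $P$-position is a position from which the previous player wins, and an $N$-position is one from which the next player wins. Equivalently: $[0,0,0]$ is an $N$-position, and a position other than $[0,0,0]$ is a $P$-position if and only if no move from it leads to a $P$-position. The function $f$. For all integers $q\ge r\ge 0$ there is a unique integer $p>r$ such that either (i) $r<p<q$ and $[p,p,r]$ is a $P$-position, or (ii) $p\ge q$ and $[p,q,r]$ is a $P$-position. This integer is denoted $f(q,r)$. *)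

theory Defs
  imports Main
begin

text \<open>
  A position of three-row Chomp is a triple of row lengths, first row first; the triples that
  are positions are those with \<open>p \<ge> q \<ge> r\<close>. Every move from a position leads to a position.
\<close>

definition chomp_moves :: "nat \<times> nat \<times> nat \<Rightarrow> (nat \<times> nat \<times> nat) set" where
  "chomp_moves = (\<lambda>(p, q, r).
     {(a, min a q, min a r) | a. a < p} \<union>
     {(p, a, min a r) | a. a < q} \<union>
     {(p, q, b) | b. b < r})"

text \<open>The player who moves to \<open>(0, 0, 0)\<close> loses, so that position is an N-position.\<close>

function P_position :: "nat \<times> nat \<times> nat \<Rightarrow> bool" where
  "P_position x \<longleftrightarrow> x \<noteq> (0, 0, 0) \<and> (\<forall>y\<in>chomp_moves x. \<not> P_position y)"
  by auto
termination
  by (relation "measure (\<lambda>(p, q, r). p + q + r)") (auto simp: chomp_moves_def)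

declare P_position.simps [simp del]

text \<open>Only meant for \<open>q \<ge> r\<close>, where exactly one such \<open>p\<close> exists.\<close>

definition chomp_f :: "nat \<Rightarrow> nat \<Rightarrow> nat" where
  "chomp_f q r = (THE p. p > r \<and>
     ((r < p \<and> p < q \<and> P_position (p, p, r)) \<or> (p \<ge> q \<and> P_position (p, q, r))))"

definition chomp_D :: "nat set" where
  "chomp_D = {chomp_f a a | a. a \<ge> 0}"

definition chomp_S :: "nat set" where
  "chomp_S = {p. p \<ge> 1 \<and> (\<exists>r. 0 \<le> r \<and> r < p \<and> chomp_f p r = p)}"

end

theory Submission
  imports Defs
begin

text \<open>
  Membership of \<open>n\<close> in \<open>D\<close> means that some \<open>(n, a, a)\<close> with \<open>a < n\<close> is a P-position, membership
  in \<open>S\<close> that some \<open>(n, n, r)\<close> with \<open>r < n\<close> is. At least one holds: since \<open>(a, a, a)\<close> is always an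
  N-position, \<open>(n, n, n - 1)\<close> is a P-position itself or has a move to a P-position of one of the
  two kinds. For disjointness, the point is that if \<open>(n, n, r)\<close> is a P-position, then each \<open>a\<close> with
  \<open>r \<le> a \<le> n\<close> has some \<open>c \<le> r\<close> such that \<open>(n, a, c)\<close> is a P-position. Otherwise take the largest
  exception \<open>a\<close>, so that each \<open>z\<close> with \<open>a < z \<le> n\<close> has a P-position \<open>(n, z, x)\<close> with \<open>x \<le> r\<close>. Then
  \<open>(n, a, x)\<close> can only be an N-position because of a P-position \<open>(p, a, x)\<close> with \<open>a < p < n\<close>.
  Different \<open>z\<close> have different \<open>x\<close> and hence different \<open>p\<close>, but there are more \<open>z\<close> than possible \<open>p\<close>.
\<close>

lemma not_P_position_move:
  assumes "P_position x" "y \<in> chomp_moves x"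
  shows "\<not> P_position y"
  using assms by (subst (asm) P_position.simps) blast

lemma N_position_move:
  assumes "\<not> P_position x" "x \<noteq> (0, 0, 0)"
  obtains y where "y \<in> chomp_moves x" "P_position y"
  using assms by (subst (asm) P_position.simps) blast

lemma not_P_position_row1:
  assumes "P_position (p, q, r)" "a < p"
  shows "\<not> P_position (a, min a q, min a r)"
  using assms(2) by (intro not_P_position_move[OF assms(1)]) (auto simp: chomp_moves_def)

lemma not_P_position_row2:
  assumes "P_position (p, q, r)" "a < q"
  shows "\<not> P_position (p, a, min a r)"
  using assms(2) by (intro not_P_position_move[OF assms(1)]) (auto simp: chomp_moves_def)

lemma not_P_position_row3:
  assumes "P_position (p, q, r)" "b < r"
  shows "\<not> P_position (p, q, b)"
  using assms(2) by (intro not_P_position_move[OF assms(1)]) (auto simp: chomp_moves_def)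

lemma N_position_cases [consumes 2]:
  assumes "\<not> P_position (p, q, r)" "0 < p"
  obtains (row1) a where "a < p" "P_position (a, min a q, min a r)"
    | (row2) a where "a < q" "P_position (p, a, min a r)"
    | (row3) b where "b < r" "P_position (p, q, b)"
  using assms by (elim N_position_move) (auto simp: chomp_moves_def)

lemma P_position_row1_unique:
  assumes "P_position (p, min p q, r)" "P_position (p', min p' q, r)" "r \<le> p" "r \<le> p'"
  shows "p = p'"
proof -
  have "\<not> s < t" if P: "P_position (s, min s q, r)" "P_position (t, min t q, r)" and "r \<le> s" for s t
  proof
    assume "s < t"
    then have "min s (min t q) = min s q" "min s r = r"
      using \<open>r \<le> s\<close> by auto
    then show False
      using not_P_position_row1[OF P(2) \<open>s < t\<close>] P(1) by simp
  qed
  with assms show ?thesis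
    by (meson linorder_neqE_nat)
qed

lemma P_position_row2_unique:
  assumes "P_position (p, q, r)" "P_position (p, q', r)" "r \<le> q" "r \<le> q'"
  shows "q = q'"
proof -
  have "\<not> s < t" if "P_position (p, s, r)" "P_position (p, t, r)" "r \<le> s" for s t
    using not_P_position_row2[OF that(2), of s] that by auto
  with assms show ?thesis
    by (meson linorder_neqE_nat)
qed

lemma P_position_row3_unique:
  assumes "P_position (p, q, r)" "P_position (p, q, r')"
  shows "r = r'"
  using assms not_P_position_row3 by (meson linorder_neqE_nat)

lemma chomp_moves_rectangle_minus_corner_subset:
  "chomp_moves (a, a, a - 1) \<subseteq> chomp_moves (a, a, a)"
  by (fastforce simp: chomp_moves_def)

lemma not_P_position_rectangle: "\<not> P_position (a, a, a)"
proof
  assume P: "P_position (a, a, a)"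
  then have "a > 0"
    by (subst (asm) P_position.simps) auto
  then have "\<not> P_position (a, a, a - 1)"
    using not_P_position_row3[OF P] by simp
  then obtain y where "y \<in> chomp_moves (a, a, a - 1)" "P_position y"
    using \<open>a > 0\<close> by (elim N_position_move) auto
  \<comment> \<open>Strategy stealing: \<open>y\<close> could have been reached directly.\<close>
  then show False
    using not_P_position_move[OF P] chomp_moves_rectangle_minus_corner_subset by blast
qed

lemma P_position_row1_or_smaller_rows:
  assumes "r \<le> q" "q < p"
  shows "(\<exists>p'>r. P_position (p', min p' q, r)) \<or> (\<exists>x\<in>{..q} \<times> {..r}. P_position (p, x))"
proof (cases "P_position (p, q, r)")
  case True
  then show ?thesis by auto
next
  case False
  moreover have "0 < p"
    using assms by simp
  ultimately show ?thesis
  proof (cases rule: N_position_cases)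
    case (row1 a)
    have "r < a"
    proof (rule ccontr)
      assume "\<not> r < a"
      then have "P_position (a, a, a)"
        using row1(2) assms by simp
      then show False
        using not_P_position_rectangle by blast
    qed
    then show ?thesis
      using row1(2) by auto
  next
    case (row2 a)
    then show ?thesis by (intro disjI2 bexI[of _ "(a, min a r)"]) auto
  next
    case (row3 b)
    then show ?thesis by (intro disjI2 bexI[of _ "(q, b)"]) auto
  qed
qed

lemma P_position_row1_exists:
  assumes "r \<le> q"
  shows "\<exists>p>r. P_position (p, min p q, r)"
proof (rule ccontr)
  assume "\<not> ?thesis"
  then have "\<forall>p\<in>{q<..}. \<exists>x\<in>{..q} \<times> {..r}. P_position (p, x)"
    using P_position_row1_or_smaller_rows[OF assms] by blast
  then obtain u v where uv: "u \<le> q" "v \<le> r" and inf: "infinite {p \<in> {q<..}. P_position (p, u, v)}"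
    using pigeonhole_infinite_rel[of "{q<..}" "{..q} \<times> {..r}" "\<lambda>p x. P_position (p, x)"]
    by (auto simp: infinite_Ioi)
  from inf obtain p where p: "q < p" "P_position (p, u, v)"
    using infinite_imp_nonempty by blast
  have "p' = p" if "q < p'" "P_position (p', u, v)" for p'
    using P_position_row1_unique[of p' u v p] that p uv assms by simp
  then have "{p \<in> {q<..}. P_position (p, u, v)} \<subseteq> {p}"
    by auto
  with inf show False
    using finite_subset by blast
qed

lemma chomp_f_eq_iff:
  assumes "r \<le> q"
  shows "chomp_f q r = p \<longleftrightarrow> r < p \<and> P_position (p, min p q, r)"
proof -
  have "chomp_f q r = (THE p. r < p \<and> P_position (p, min p q, r))"
    unfolding chomp_f_def by (rule arg_cong[where f = The]) (auto simp: fun_eq_iff min_def le_less)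
  moreover have "\<exists>!p. r < p \<and> P_position (p, min p q, r)"
    using P_position_row1_exists[OF assms] P_position_row1_unique by (meson less_imp_le)
  ultimately show ?thesis
    by (metis (mono_tags, lifting) theI')
qed

lemma chomp_D_iff: "n \<in> chomp_D \<longleftrightarrow> (\<exists>a<n. P_position (n, a, a))"
proof -
  have "n \<in> chomp_D \<longleftrightarrow> (\<exists>a. chomp_f a a = n)"
    by (auto simp: chomp_D_def)
  then show ?thesis
    by (auto simp: chomp_f_eq_iff)
qed

lemma chomp_S_iff: "n \<in> chomp_S \<longleftrightarrow> (\<exists>r<n. P_position (n, n, r))"
  by (auto simp: chomp_S_def chomp_f_eq_iff)

lemma P_position_two_equal_rows_exists:
  assumes "0 < n"
  shows "(\<exists>a<n. P_position (n, a, a)) \<or> (\<exists>r<n. P_position (n, n, r))"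
proof (cases "P_position (n, n, n - 1)")
  case True
  then show ?thesis
    using assms by (metis diff_less zero_less_one)
next
  case False
  then show ?thesis
    using assms
  proof (cases rule: N_position_cases)
    case (row1 a)
    then have "min a n = a" "min a (n - 1) = a" by auto
    then show ?thesis
      using row1 not_P_position_rectangle by simp
  next
    case (row2 a)
    then have "min a (n - 1) = a" by simp
    then show ?thesis
      using row2 by auto
  next
    case (row3 b)
    then have "b < n" by simp
    then show ?thesis
      using row3 by blast
  qed
qed

lemma P_position_shorten_row2_cases:
  assumes P: "P_position (n, z, x)" and "x \<le> a" "a < z" "z \<le> n"
  obtains (row1) p where "p \<in> {a<..<n}" "P_position (p, a, x)"
    | (row3) b where "b < x" "P_position (n, a, b)"
proof -
  have "\<not> P_position (n, a, x)" "0 < n"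
    using not_P_position_row2[OF P \<open>a < z\<close>] assms by simp_all
  then show thesis
  proof (cases rule: N_position_cases)
    case (row1 p)
    have "a < p"
    proof (rule ccontr)
      assume "\<not> a < p"
      then have "min p z = min p a"
        using \<open>a < z\<close> by simp
      then show False
        using not_P_position_row1[OF P row1(1)] row1(2) by simp
    qed
    then show thesis
      using row1 \<open>x \<le> a\<close> that(1)[of p] by simp
  next
    case (row2 e)
    then show thesis
      using not_P_position_row2[OF P, of e] \<open>a < z\<close> by simp
  next
    case (row3 b)
    then show thesis
      using that(2) by blast
  qed
qed

lemma P_position_row3_exists_if_above:
  assumes above: "\<And>z. z \<in> {a<..n} \<Longrightarrow> \<exists>x\<le>r. P_position (n, z, x)" and "r \<le> a" "a < n"
  shows "\<exists>c\<le>r. P_position (n, a, c)"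
proof (rule ccontr)
  assume none: "\<not> ?thesis"
  obtain x where x: "\<And>z. z \<in> {a<..n} \<Longrightarrow> x z \<le> r \<and> P_position (n, z, x z)"
    using above by metis
  have "\<exists>p\<in>{a<..<n}. P_position (p, a, x z)" if z: "z \<in> {a<..n}" for z
  proof -
    have "P_position (n, z, x z)" "x z \<le> a" "a < z" "z \<le> n"
      using x[OF z] z \<open>r \<le> a\<close> by auto
    then show ?thesis
    proof (cases rule: P_position_shorten_row2_cases)
      case (row3 b)
      then show ?thesis
        using none x[OF z] by (meson less_imp_le order_trans)
    qed blast
  qed
  then obtain g where g: "\<And>z. z \<in> {a<..n} \<Longrightarrow> g z \<in> {a<..<n} \<and> P_position (g z, a, x z)"
    by metis
  have "inj_on g {a<..n}"
  proof (rule inj_onI)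
    fix z z' assume z: "z \<in> {a<..n}" and z': "z' \<in> {a<..n}" and "g z = g z'"
    then have "x z = x z'"
      using g P_position_row3_unique by metis
    then show "z = z'"
      using P_position_row2_unique[of n z "x z" z'] x[OF z] x[OF z'] z z' \<open>r \<le> a\<close> by simp
  qed
  then have "card {a<..n} \<le> card {a<..<n}"
    using g by (intro card_inj_on_le) auto
  then show False
    using \<open>a < n\<close> by simp
qed

lemma P_position_row3_exists:
  assumes P: "P_position (n, n, r)" and "r \<le> a" "a \<le> n"
  shows "\<exists>c\<le>r. P_position (n, a, c)"
  using \<open>r \<le> a\<close> \<open>a \<le> n\<close>
proof (induction "n - a" arbitrary: a rule: less_induct)
  case less
  show ?case
  proof (cases "a = n")
    case True
    then show ?thesis using P by blast
  next
    case False
    show ?thesis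
    proof (rule P_position_row3_exists_if_above)
      fix z assume "z \<in> {a<..n}"
      then have "n - z < n - a" "r \<le> z" "z \<le> n"
        using less.prems by auto
      then show "\<exists>x\<le>r. P_position (n, z, x)"
        by (rule less.hyps)
    qed (use less.prems False in simp_all)
  qed
qed

lemma not_P_position_first_and_last_rows_equal:
  assumes P: "P_position (n, a, a)" and "a < n"
  shows "\<not> P_position (n, n, r)"
proof
  assume Q: "P_position (n, n, r)"
  have "r < a"
    using not_P_position_row2[OF Q \<open>a < n\<close>] P by (cases "a \<le> r") auto
  then obtain c where c: "c \<le> r" "P_position (n, a, c)"
    using P_position_row3_exists[OF Q] \<open>a < n\<close> by (meson less_imp_le)
  show False
    using P_position_row3_unique[OF P c(2)] c(1) \<open>r < a\<close> by simp
qed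

theorem proposition4p4:
  fixes n :: nat
  assumes "n \<ge> 1"
  shows "(n \<in> chomp_D \<or> n \<in> chomp_S) \<and> \<not> (n \<in> chomp_D \<and> n \<in> chomp_S)"
proof
  show "n \<in> chomp_D \<or> n \<in> chomp_S"
    using P_position_two_equal_rows_exists assms by (simp add: chomp_D_iff chomp_S_iff)
  show "\<not> (n \<in> chomp_D \<and> n \<in> chomp_S)"
    using not_P_position_first_and_last_rows_equal unfolding chomp_D_iff chomp_S_iff by blast
qed

end
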